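(* Let $\mathcal{Y}=\{0,\dots,K-1\}$, and let $(X_1,Y_1),\dots,(X_n,Y_n),(X_{test},Y_{test})$ be exchangeable random pairs with values in $\mathcal{X}\times\mathcal{Y}$. For $\lambda\in\Lambda$ and $x\in\mathcal{X}$ let $C_\lambda(x)=[l(\lambda),u(\lambda)]=\{l(\lambda),l(\lambda)+1,\dots,u(\lambda)\}\subseteq\mathcal{Y}$ (the endpoints depending also on $x$). Suppose that $l(\lambda)$ is decreasing and $u(\lambda)$ is increasing in $\lambda$ (both in the weak sense), that both are right-continuous, and that there is $\lambda_0\in\Lambda$ with $[l(\lambda_0),u(\lambda_0)]=\mathcal{Y}$. Let $$L(y,C)=g(y,C)\,\mathbf{1}(y\notin C),$$ where the weight function $g$ is nonnegative and decreasing in $C$, i.e. $g(y,C_1)\ge g(y,C_2)$ whenever $C_1\subseteq C_2\subseteq\mathcal{Y}$, and where $\sup_\lambda L(Y,C_\lambda(X))\le B<\infty$ almost surely for each of the $n+1$ pairs $(X,Y)$. Put $L_i(\lambda)=L(Y_i,C_\lambda(X_i))$ for $i=1,\dots,n$, let $\alpha\in(0,B)$ be the desired risk level upper bound, and let $$\hat\lambda=\inf\Big\{\lambda:\ \sum_{i=1}^n L_i(\lambda)\le (n+1)\alpha-B\Big\}.$$ Then $$E\big[L(Y_{test},C_{\hat\lambda}(X_{test}))\big]\le\alpha .$$ Moreover, write $L_{n+1}(\lambda)=L(Y_{test},C_\lambda(X_{test}))$. If in addition the random functions $L_1,\dots,L_{n+1}$ are i.i.d., $L_i\ge 0$, and there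 is a non-negative integer $M$ such that $\sup_{\lambda\in\Lambda}s(\lambda)\le M$ almost surely, then $$\alpha-\frac{(M+2)B}{n+1}\le E\big[L(Y_{test},C_{\hat\lambda}(X_{test}))\big].$$
   Context: $\Lambda$ is the set of thresholds $\lambda$ indexing the prediction sets $C_\lambda$. For a function $\mathcal{L}$ of $\lambda$, the jump function is $J(\mathcal{L},\lambda)=\lim_{\epsilon\to0+}\mathcal{L}(\lambda-\epsilon)-\mathcal{L}(\lambda)$, the size of the discontinuity of $\mathcal{L}$ at $\lambda$. The quantity $s(\lambda)=|\{i\in\{1,\dots,n+1\}: J(L_i,\lambda)>0\}|$ is the number of the functions $L_i$ that are discontinuous at $\lambda$.
   Formalization: It is assumed that the infimum defining λ̂ exists and lies in Λ (λ̂=λ₀ if the set is empty); for the lower bound, also that a.s., if the set is nonempty, Λ approaches λ̂ from the left, so that J(·,λ̂) is a true left limit; otherwise Λ=[0,1], C_λ=𝒴 is a counterexample. *)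

theory Defs
  imports "HOL-Probability.Probability" "HOL-Combinatorics.Permutations"
begin

definition exchangeable :: "'w measure \<Rightarrow> 'i set \<Rightarrow> 'z measure \<Rightarrow> ('i \<Rightarrow> 'w \<Rightarrow> 'z) \<Rightarrow> bool" where
  "exchangeable P I N Z \<longleftrightarrow>
     (\<forall>i\<in>I. Z i \<in> measurable P N) \<and>
     (\<forall>\<pi>. \<pi> permutes I \<longrightarrow>
        distr P (Pi\<^sub>M I (\<lambda>_. N)) (\<lambda>\<omega>. \<lambda>i\<in>I. Z (\<pi> i) \<omega>) =
        distr P (Pi\<^sub>M I (\<lambda>_. N)) (\<lambda>\<omega>. \<lambda>i\<in>I. Z i \<omega>))"

definition iid_vars :: "'w measure \<Rightarrow> 'i set \<Rightarrow> 'z measure \<Rightarrow> ('i \<Rightarrow> 'w \<Rightarrow> 'z) \<Rightarrow> bool" where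
  "iid_vars P I N Z \<longleftrightarrow>
     prob_space.indep_vars P (\<lambda>_. N) Z I \<and> (\<forall>i\<in>I. \<forall>j\<in>I. distr P N (Z i) = distr P N (Z j))"

(* Random real functions on Lambda are random elements of the product space, i.e. their law is
   given by the finite-dimensional distributions. *)
definition iid_functions ::
    "'w measure \<Rightarrow> 'i set \<Rightarrow> real set \<Rightarrow> ('w \<Rightarrow> 'i \<Rightarrow> real \<Rightarrow> real) \<Rightarrow> bool" where
  "iid_functions P I \<Lambda> L \<longleftrightarrow>
     iid_vars P I (Pi\<^sub>M \<Lambda> (\<lambda>_. borel)) (\<lambda>i \<omega>. \<lambda>t\<in>\<Lambda>. L \<omega> i t)"

definition labels :: "nat \<Rightarrow> int set" where
  "labels K = {0..int K - 1}"

(* An integer interval; it is empty when the lower endpoint exceeds the upper one. *)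
definition pred_set :: "(real \<Rightarrow> 'x \<Rightarrow> int) \<Rightarrow> (real \<Rightarrow> 'x \<Rightarrow> int) \<Rightarrow> real \<Rightarrow> 'x \<Rightarrow> int set" where
  "pred_set l u t x = {l t x..u t x}"

definition ord_loss :: "(int \<Rightarrow> int set \<Rightarrow> real) \<Rightarrow> int \<Rightarrow> int set \<Rightarrow> real" where
  "ord_loss g y C = g y C * of_bool (y \<notin> C)"

definition right_cont_on :: "real set \<Rightarrow> (real \<Rightarrow> 'b::topological_space) \<Rightarrow> bool" where
  "right_cont_on \<Lambda> f \<longleftrightarrow> (\<forall>t\<in>\<Lambda>. (f \<longlongrightarrow> f t) (at t within (\<Lambda> \<inter> {t<..})))"

definition calib_set :: "real set \<Rightarrow> nat \<Rightarrow> real \<Rightarrow> real \<Rightarrow> (nat \<Rightarrow> real \<Rightarrow> real) \<Rightarrow> real set" where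
  "calib_set \<Lambda> n \<alpha> B L = {t\<in>\<Lambda>. (\<Sum>i=1..n. L i t) \<le> (real n + 1) * \<alpha> - B}"

(* The infimum of the empty set is read as top, where t0 is a threshold whose prediction set is
   the whole label set. Every threshold above t0 gives the same prediction set as t0, so any
   other choice of a top threshold leads to the same loss. *)
definition threshold ::
    "real set \<Rightarrow> real \<Rightarrow> nat \<Rightarrow> real \<Rightarrow> real \<Rightarrow> (nat \<Rightarrow> real \<Rightarrow> real) \<Rightarrow> real" where
  "threshold \<Lambda> t0 n \<alpha> B L =
     (if calib_set \<Lambda> n \<alpha> B L = {} then t0 else Inf (calib_set \<Lambda> n \<alpha> B L))"

(* The left limit is taken along Lambda. At a point that Lambda does not approach from the left
   there is no left limit; the jump is set to 0 there. *)
definition jump :: "real set \<Rightarrow> (real \<Rightarrow> real) \<Rightarrow> real \<Rightarrow> real" where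
  "jump \<Lambda> f t =
     (if t islimpt (\<Lambda> \<inter> {..<t}) then Lim (at t within (\<Lambda> \<inter> {..<t})) f - f t else 0)"

definition jump_count :: "real set \<Rightarrow> nat \<Rightarrow> (nat \<Rightarrow> real \<Rightarrow> real) \<Rightarrow> real \<Rightarrow> nat" where
  "jump_count \<Lambda> n L t = card {i\<in>{1..n+1}. jump \<Lambda> (L i) t > 0}"

end

theory Submission
  imports Defs
begin

text \<open>Each loss is a nonincreasing step function of the threshold with values in a fixed finite set.
  Put \<open>c = (n + 1) \<alpha> - B\<close>; if \<open>c < 0\<close>, the test loss vanishes and both bounds are trivial.

  Upper bound: the total of all \<open>n + 1\<close> losses at the calibrated threshold is at most \<open>c + B\<close>, so the
  test loss there is at most its value at the smallest threshold with this property. That threshold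
  is symmetric in the \<open>n + 1\<close> pairs, so the expected test loss there is the expected average of all
  losses, which is at most \<open>(c + B) / (n + 1) = \<alpha>\<close>.

  Lower bound: by exchangeability the expected test loss is the average over \<open>j\<close> of the expected loss
  of the \<open>j\<close>-th pair at the threshold \<open>t\<^sub>j\<close> calibrated on the other \<open>n\<close> pairs. By monotonicity these
  losses only decrease when every \<open>t\<^sub>j\<close> is replaced by the largest one, \<open>t\<^sub>m\<close>. Just to the left of \<open>t\<^sub>m\<close>
  the losses of the pairs other than \<open>m\<close> sum to more than \<open>c\<close>, and at most \<open>M\<close> of them jump at \<open>t\<^sub>m\<close>,
  each by at most \<open>B\<close>, so their sum at \<open>t\<^sub>m\<close> is at least \<open>c - M B\<close>.\<close>

section \<open>Exchangeable families\<close>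

lemma exchangeable_vec_measurable:
  assumes "exchangeable P I N Z" "\<pi> permutes I"
  shows "(\<lambda>\<omega>. \<lambda>i\<in>I. Z (\<pi> i) \<omega>) \<in> measurable P (Pi\<^sub>M I (\<lambda>_. N))"
  using assms by (intro measurable_restrict) (auto simp: exchangeable_def permutes_in_image)

lemma exchangeable_vec_measurable_id:
  assumes "exchangeable P I N Z"
  shows "(\<lambda>\<omega>. \<lambda>i\<in>I. Z i \<omega>) \<in> measurable P (Pi\<^sub>M I (\<lambda>_. N))"
  using exchangeable_vec_measurable[OF assms permutes_id] by simp

lemma exchangeable_distr:
  assumes "exchangeable P I N Z" "\<pi> permutes I"
  shows "distr P (Pi\<^sub>M I (\<lambda>_. N)) (\<lambda>\<omega>. \<lambda>i\<in>I. Z (\<pi> i) \<omega>) =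
         distr P (Pi\<^sub>M I (\<lambda>_. N)) (\<lambda>\<omega>. \<lambda>i\<in>I. Z i \<omega>)"
  using assms by (auto simp: exchangeable_def)

lemma exchangeable_integral:
  fixes F :: "('i \<Rightarrow> 'z) \<Rightarrow> real"
  assumes ex: "exchangeable P I N Z" "\<pi> permutes I"
    and F: "F \<in> borel_measurable (Pi\<^sub>M I (\<lambda>_. N))"
  shows "(\<integral>\<omega>. F (\<lambda>i\<in>I. Z (\<pi> i) \<omega>) \<partial>P) = (\<integral>\<omega>. F (\<lambda>i\<in>I. Z i \<omega>) \<partial>P)"
  using integral_distr[OF exchangeable_vec_measurable[OF ex] F]
    integral_distr[OF exchangeable_vec_measurable_id[OF ex(1)] F] exchangeable_distr[OF ex]
  by simp

text \<open>Almost sure validity of a measurable property depends only on the joint law, which a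
  permutation leaves unchanged.\<close>

lemma exchangeable_AE:
  assumes ex: "exchangeable P I N Z" "\<pi> permutes I"
    and S: "{z \<in> space (Pi\<^sub>M I (\<lambda>_. N)). Q z} \<in> sets (Pi\<^sub>M I (\<lambda>_. N))"
    and ae: "AE \<omega> in P. Q (\<lambda>i\<in>I. Z i \<omega>)"
  shows "AE \<omega> in P. Q (\<lambda>i\<in>I. Z (\<pi> i) \<omega>)"
  using ae
  unfolding AE_distr_iff[OF exchangeable_vec_measurable[OF ex] S, symmetric]
    AE_distr_iff[OF exchangeable_vec_measurable_id[OF ex(1)] S, symmetric] exchangeable_distr[OF ex] .

section \<open>Step functions on a set of reals\<close>

text \<open>Supplies the countable index set that makes the supremum in \<open>opt\<close>
  measurable. \<open>D\<^sub>2\<close> picks a point of \<Lambda> from each rational interval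
  meeting it. A point with a gap of \<Lambda> to its right is recovered in \<open>D\<^sub>1\<close>
  as the largest point of \<Lambda> below a rational in that gap.\<close>

lemma right_dense_countable:
  fixes \<Lambda> :: "real set"
  obtains D where "countable D" "D \<subseteq> \<Lambda>"
    "\<And>t e. t \<in> \<Lambda> \<Longrightarrow> e > 0 \<Longrightarrow> \<exists>d\<in>D. t \<le> d \<and> d < t + e"
proof
  define D\<^sub>1 where "D\<^sub>1 = (\<lambda>q. Sup (\<Lambda> \<inter> {..<q})) ` \<rat>"
  define D\<^sub>2 where "D\<^sub>2 = (\<lambda>(p, q). SOME x. x \<in> \<Lambda> \<and> p < x \<and> x < q) ` (\<rat> \<times> \<rat>)"
  let ?D = "(D\<^sub>1 \<union> D\<^sub>2) \<inter> \<Lambda>"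
  show "countable ?D"
    unfolding D\<^sub>1_def D\<^sub>2_def by (intro countable_Int1 countable_Un countable_image countable_SIGMA countable_rat)
  show "?D \<subseteq> \<Lambda>" by blast
  fix t e :: real assume t: "t \<in> \<Lambda>" and e: "e > 0"
  show "\<exists>d\<in>?D. t \<le> d \<and> d < t + e"
  proof (cases "\<exists>x\<in>\<Lambda>. t < x \<and> x < t + e")
    case True
    then obtain x where x: "x \<in> \<Lambda>" "t < x" "x < t + e" by blast
    obtain p where p: "p \<in> \<rat>" "t < p" "p < x" using Rats_dense_in_real[OF x(2)] by blast
    obtain q where q: "q \<in> \<rat>" "x < q" "q < t + e" using Rats_dense_in_real[OF x(3)] by blast
    define d where "d = (SOME x. x \<in> \<Lambda> \<and> p < x \<and> x < q)"
    have "d \<in> \<Lambda> \<and> p < d \<and> d < q"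
      unfolding d_def by (rule someI[of _ x]) (use x p q in auto)
    moreover have "d \<in> D\<^sub>2" unfolding D\<^sub>2_def d_def using p q by force
    ultimately show ?thesis using p q by (intro bexI[of _ d]) auto
  next
    case False
    obtain q where q: "q \<in> \<rat>" "t < q" "q < t + e" using Rats_dense_in_real[of t "t + e"] e by auto
    have "Sup (\<Lambda> \<inter> {..<q}) = t"
      using False t q by (intro cSup_eq_maximum) (auto simp: not_less intro: leI)
    then have "t \<in> D\<^sub>1" unfolding D\<^sub>1_def using q by (auto intro: image_eqI[of _ _ q])
    with t e show ?thesis by (intro bexI[of _ t]) auto
  qed
qed

text \<open>Among the finitely many values to the left of \<open>t\<close> there is a least one.
  From a point \<open>s\<close> attaining it, monotonicity keeps \<open>f\<close> constant up to
  \<open>t\<close>, so the left limit is a value that \<open>f\<close> takes.\<close>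

lemma jump_finite_range:
  fixes f :: "real \<Rightarrow> real"
  assumes mono: "antimono_on \<Lambda> f" and fin: "finite (f ` \<Lambda>)"
    and lim: "t islimpt (\<Lambda> \<inter> {..<t})"
  obtains s where "s \<in> \<Lambda>" "s < t" "\<And>r. r \<in> \<Lambda> \<Longrightarrow> s \<le> r \<Longrightarrow> r < t \<Longrightarrow> jump \<Lambda> f t = f r - f t"
proof -
  let ?S = "\<Lambda> \<inter> {..<t}"
  have ne: "?S \<noteq> {}" using lim by (auto simp: islimpt_def)
  have finS: "finite (f ` ?S)" by (rule finite_subset[OF _ fin]) auto
  obtain s where s: "s \<in> ?S" "f s = Min (f ` ?S)"
    using Min_in[OF finS] ne by (metis (no_types, lifting) empty_is_image imageE)
  have const: "f r = f s" if "r \<in> \<Lambda>" "s \<le> r" "r < t" for r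
  proof (rule antisym)
    show "f r \<le> f s" using monotone_onD[OF mono, of s r] that s by auto
    show "f s \<le> f r" using Min_le[OF finS] that s by auto
  qed
  have "eventually (\<lambda>r. f r = f s) (at t within ?S)"
    unfolding eventually_at_topological
  proof (intro exI[of _ "{s<..}"] conjI ballI impI)
    show "f r = f s" if "r \<in> {s<..}" "r \<in> ?S" for r
      by (rule const) (use that in auto)
  qed (use s in auto)
  then have "(f \<longlongrightarrow> f s) (at t within ?S)" by (rule tendsto_eventually)
  then have "Lim (at t within ?S) f = f s"
    by (intro tendsto_Lim) (use lim in \<open>auto simp: trivial_limit_within\<close>)
  then have J: "jump \<Lambda> f t = f s - f t" using lim by (simp add: jump_def)
  show thesis
  proof (rule that)
    show "jump \<Lambda> f t = f r - f t" if "r \<in> \<Lambda>" "s \<le> r" "r < t" for r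
      using J const[OF that] by simp
  qed (use s in auto)
qed

section \<open>Step losses and their leave-out thresholds\<close>

text \<open>Isolates what the argument uses of the prediction sets, with \<open>z\<close> a labelled
  example. One finite value set \<open>V\<close> for all \<open>z\<close> bounds the losses by
  \<open>Max V\<close> everywhere, whereas the bound B of the theorem holds only almost surely; this
  gives integrability of \<open>opt\<close> and lets maxima over thresholds be attained.\<close>

locale step_loss =
  fixes N :: "'z measure" and \<Lambda> D :: "real set" and t\<^sub>0 :: real and V :: "real set"
    and ell :: "real \<Rightarrow> 'z \<Rightarrow> real"
  assumes ell_measurable: "\<And>t. t \<in> \<Lambda> \<Longrightarrow> ell t \<in> borel_measurable N"
    and ell_antimono: "\<And>s t z. z \<in> space N \<Longrightarrow> s \<in> \<Lambda> \<Longrightarrow> t \<in> \<Lambda> \<Longrightarrow> s \<le> t \<Longrightarrow> ell t z \<le> ell s z"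
    and ell_nonneg: "\<And>t z. z \<in> space N \<Longrightarrow> t \<in> \<Lambda> \<Longrightarrow> 0 \<le> ell t z"
    and finite_values: "finite V"
    and ell_values: "\<And>t z. z \<in> space N \<Longrightarrow> t \<in> \<Lambda> \<Longrightarrow> ell t z \<in> V"
    and ell_right_const: "\<And>t z. z \<in> space N \<Longrightarrow> t \<in> \<Lambda> \<Longrightarrow>
      \<exists>e>0. \<forall>s\<in>\<Lambda>. t \<le> s \<longrightarrow> s < t + e \<longrightarrow> ell s z = ell t z"
    and top_mem: "t\<^sub>0 \<in> \<Lambda>"
    and ell_top: "\<And>z. z \<in> space N \<Longrightarrow> ell t\<^sub>0 z = 0"
    and countable_D: "countable D"
    and D_subset: "D \<subseteq> \<Lambda>"
    and D_dense: "\<And>t e. t \<in> \<Lambda> \<Longrightarrow> e > 0 \<Longrightarrow> \<exists>d\<in>D. t \<le> d \<and> d < t + e"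
begin

section \<open>Total losses and their optimal feasible values: attainment, bounds,
  measurability\<close>

definition risk :: "'i set \<Rightarrow> ('i \<Rightarrow> 'z) \<Rightarrow> real \<Rightarrow> real" where
  "risk A z t = (\<Sum>i\<in>A. ell t (z i))"

text \<open>The total loss over \<open>H\<close> at the smallest threshold whose total loss over \<open>A\<close> is at most \<open>c\<close>.
  It makes sense also where that smallest threshold fails to lie in \<open>\<Lambda>\<close>, and the supremum over
  the countable set \<open>D\<close> makes it measurable.\<close>

definition opt :: "'i set \<Rightarrow> 'i set \<Rightarrow> real \<Rightarrow> ('i \<Rightarrow> 'z) \<Rightarrow> real" where
  "opt A H c z = (SUP d\<in>D. if risk A z d \<le> c then risk H z d else 0)"

lemma risk_right_const:
  assumes "finite I" "z \<in> I \<rightarrow> space N" "t \<in> \<Lambda>"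
  shows "\<exists>e>0. \<forall>s\<in>\<Lambda>. t \<le> s \<longrightarrow> s < t + e \<longrightarrow> (\<forall>i\<in>I. ell s (z i) = ell t (z i))"
  using assms
proof (induction I)
  case empty
  show ?case by (rule exI[of _ 1]) auto
next
  case (insert j I)
  then obtain e where e: "e > 0" "\<forall>s\<in>\<Lambda>. t \<le> s \<longrightarrow> s < t + e \<longrightarrow> (\<forall>i\<in>I. ell s (z i) = ell t (z i))"
    by auto
  obtain e' where e': "e' > 0" "\<forall>s\<in>\<Lambda>. t \<le> s \<longrightarrow> s < t + e' \<longrightarrow> ell s (z j) = ell t (z j)"
    using ell_right_const[of "z j" t] insert.prems by auto
  show ?case by (rule exI[of _ "min e e'"]) (use e e' in auto)
qed

lemma risk_cong_ell:
  assumes "A \<subseteq> I" "\<forall>i\<in>I. ell s (z i) = ell t (z i)"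
  shows "risk A z s = risk A z t"
  unfolding risk_def by (rule sum.cong) (use assms in auto)

lemma risk_nonneg:
  assumes "z \<in> A \<rightarrow> space N" "t \<in> \<Lambda>"
  shows "0 \<le> risk A z t"
  unfolding risk_def by (rule sum_nonneg) (use assms ell_nonneg in auto)

lemma risk_antimono:
  assumes "z \<in> A \<rightarrow> space N" "s \<in> \<Lambda>" "t \<in> \<Lambda>" "s \<le> t"
  shows "risk A z t \<le> risk A z s"
  unfolding risk_def by (rule sum_mono) (use assms ell_antimono in auto)

lemma risk_finite_range:
  assumes "finite I" "z \<in> I \<rightarrow> space N" "S \<subseteq> \<Lambda>"
  shows "finite (risk I z ` S)"
proof (rule finite_subset)
  show "risk I z ` S \<subseteq> (\<lambda>f. \<Sum>i\<in>I. f i) ` (I \<rightarrow>\<^sub>E V)"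
  proof
    fix x assume "x \<in> risk I z ` S"
    then obtain t where t: "t \<in> S" "x = risk I z t" by auto
    have "(\<lambda>i\<in>I. ell t (z i)) \<in> I \<rightarrow>\<^sub>E V" using t assms ell_values by auto
    moreover have "x = (\<Sum>i\<in>I. (\<lambda>i\<in>I. ell t (z i)) i)" using t by (simp add: risk_def)
    ultimately show "x \<in> (\<lambda>f. \<Sum>i\<in>I. f i) ` (I \<rightarrow>\<^sub>E V)" by blast
  qed
  show "finite ((\<lambda>f. \<Sum>i\<in>I. f i) ` (I \<rightarrow>\<^sub>E V))"
    using assms finite_values by (intro finite_imageI finite_PiE) auto
qed

text \<open>By \<open>dom\<close>, \<open>t\<close> behaves like a smallest feasible threshold. It
  need not lie in \<open>D\<close>, but right-constancy gives a point of \<open>D\<close> with the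
  same losses, so the supremum is attained; infeasible points contribute only 0.\<close>

lemma opt_eqI:
  assumes I: "finite I" "z \<in> I \<rightarrow> space N" "A \<subseteq> I" "H \<subseteq> I"
    and t: "t \<in> \<Lambda>" "risk A z t \<le> c"
    and dom: "\<And>s i. s \<in> \<Lambda> \<Longrightarrow> risk A z s \<le> c \<Longrightarrow> i \<in> H \<Longrightarrow> ell s (z i) \<le> ell t (z i)"
  shows "opt A H c z = risk H z t"
  unfolding opt_def
proof (rule cSup_eq_maximum)
  obtain e where e: "e > 0" "\<forall>s\<in>\<Lambda>. t \<le> s \<longrightarrow> s < t + e \<longrightarrow> (\<forall>i\<in>I. ell s (z i) = ell t (z i))"
    using risk_right_const[OF I(1,2) t(1)] by auto
  obtain d where d: "d \<in> D" "t \<le> d" "d < t + e" using D_dense[OF t(1) e(1)] by auto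
  then have "\<forall>i\<in>I. ell d (z i) = ell t (z i)" using e D_subset by auto
  then have "risk A z d = risk A z t" "risk H z d = risk H z t"
    using risk_cong_ell I by blast+
  then show "risk H z t \<in> (\<lambda>d. if risk A z d \<le> c then risk H z d else 0) ` D"
    using t d by (auto intro!: image_eqI[of _ _ d])
next
  have H: "z \<in> H \<rightarrow> space N" using I by auto
  fix x assume "x \<in> (\<lambda>d. if risk A z d \<le> c then risk H z d else 0) ` D"
  then obtain d where d: "d \<in> D" "x = (if risk A z d \<le> c then risk H z d else 0)" by auto
  show "x \<le> risk H z t"
  proof (cases "risk A z d \<le> c")
    case True
    have "risk H z d \<le> risk H z t"
      unfolding risk_def by (rule sum_mono) (use True d D_subset dom in auto)
    with True d show ?thesis by simp
  next
    case False
    with d risk_nonneg[OF H t(1)] show ?thesis by simp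
  qed
qed

text \<open>Take a feasible \<open>t\<close> maximising the total loss over \<open>I\<close>. Every
  loss is monotone in the threshold, so a feasible \<open>s\<close> with one larger loss would lie
  below \<open>t\<close>, hence have no smaller loss and a strictly larger total. Thus
  \<open>t\<close> maximises all losses at once and serves every \<open>H\<close>, even if the
  infimum of the feasible thresholds is not in \<Lambda>.\<close>

lemma opt_attained:
  assumes I: "finite I" "z \<in> I \<rightarrow> space N" "A \<subseteq> I" and c: "0 \<le> c"
  obtains t where "t \<in> \<Lambda>" "risk A z t \<le> c"
    "\<And>s i. s \<in> \<Lambda> \<Longrightarrow> risk A z s \<le> c \<Longrightarrow> i \<in> I \<Longrightarrow> ell s (z i) \<le> ell t (z i)"
    "\<And>H. H \<subseteq> I \<Longrightarrow> opt A H c z = risk H z t"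
proof -
  let ?S = "{t\<in>\<Lambda>. risk A z t \<le> c}"
  have fin: "finite (risk I z ` ?S)" by (rule risk_finite_range) (use I in auto)
  have "risk A z t\<^sub>0 = 0"
    unfolding risk_def by (rule sum.neutral) (use I ell_top in auto)
  then have ne: "?S \<noteq> {}" using top_mem c by auto
  obtain t where t: "t \<in> ?S" "risk I z t = Max (risk I z ` ?S)"
    using Max_in[OF fin] ne by (metis (no_types, lifting) empty_is_image imageE)
  have dom: "ell s (z i) \<le> ell t (z i)" if s: "s \<in> \<Lambda>" "risk A z s \<le> c" "i \<in> I" for s i
  proof (cases "t \<le> s")
    case True
    then show ?thesis using ell_antimono[of "z i" t s] s t I by auto
  next
    case False
    have le: "ell t (z j) \<le> ell s (z j)" if "j \<in> I" for j
      using ell_antimono[of "z j" s t] s t I that False by auto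
    have "risk I z s \<le> risk I z t" using Max_ge[OF fin, of "risk I z s"] s t by auto
    moreover have "risk I z t < risk I z s" if "ell t (z i) < ell s (z i)"
      unfolding risk_def by (rule sum_strict_mono_ex1) (use I le s that in auto)
    ultimately show ?thesis by fastforce
  qed
  show thesis
  proof (rule that[of t])
    show "opt A H c z = risk H z t" if "H \<subseteq> I" for H
      using t dom that by (intro opt_eqI[OF I that]) auto
  qed (use t dom in auto)
qed

lemma opt_nonneg:
  assumes "finite I" "z \<in> I \<rightarrow> space N" "A \<subseteq> I" "H \<subseteq> I" "0 \<le> c"
  shows "0 \<le> opt A H c z"
proof -
  obtain t where t: "t \<in> \<Lambda>" "\<And>H. H \<subseteq> I \<Longrightarrow> opt A H c z = risk H z t"
    using opt_attained[OF assms(1-3,5)] by metis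
  then show ?thesis using risk_nonneg[of z H t] assms by auto
qed

lemma ell_le_Max:
  assumes "z \<in> space N" "t \<in> \<Lambda>"
  shows "ell t z \<le> Max V"
  using ell_values[OF assms] finite_values by simp

lemma risk_le_Max:
  assumes "z \<in> H \<rightarrow> space N" "t \<in> \<Lambda>"
  shows "risk H z t \<le> real (card H) * Max V"
  unfolding risk_def by (rule sum_bounded_above) (use assms ell_le_Max in auto)

lemma opt_le_Max:
  assumes "finite I" "z \<in> I \<rightarrow> space N" "A \<subseteq> I" "H \<subseteq> I" "0 \<le> c"
  shows "opt A H c z \<le> real (card H) * Max V"
proof -
  obtain t where t: "t \<in> \<Lambda>" "\<And>H. H \<subseteq> I \<Longrightarrow> opt A H c z = risk H z t"
    using opt_attained[OF assms(1-3,5)] by metis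
  then show ?thesis using risk_le_Max[of z H t] assms by auto
qed

lemma risk_measurable:
  assumes "A \<subseteq> I" "t \<in> \<Lambda>"
  shows "(\<lambda>z. risk A z t) \<in> borel_measurable (Pi\<^sub>M I (\<lambda>_. N))"
  unfolding risk_def
proof (rule borel_measurable_sum)
  fix i assume "i \<in> A"
  then have "(\<lambda>z. z i) \<in> measurable (Pi\<^sub>M I (\<lambda>_. N)) N" using assms by auto
  then show "(\<lambda>z. ell t (z i)) \<in> borel_measurable (Pi\<^sub>M I (\<lambda>_. N))"
    using ell_measurable[OF assms(2)] by (rule measurable_compose)
qed

lemma space_PiM_Pi: "z \<in> space (Pi\<^sub>M I (\<lambda>_. N)) \<Longrightarrow> z \<in> I \<rightarrow> space N"
  by (auto simp: space_PiM)

lemma opt_measurable: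
  assumes "finite I" "A \<subseteq> I" "H \<subseteq> I"
  shows "opt A H c \<in> borel_measurable (Pi\<^sub>M I (\<lambda>_. N))"
  unfolding opt_def
proof (rule borel_measurable_cSUP[OF countable_D])
  fix d assume "d \<in> D"
  then have "d \<in> \<Lambda>" using D_subset by auto
  from risk_measurable[OF assms(2) this] risk_measurable[OF assms(3) this]
  show "(\<lambda>z. if risk A z d \<le> c then risk H z d else 0) \<in> borel_measurable (Pi\<^sub>M I (\<lambda>_. N))"
    by measurable
next
  fix z assume "z \<in> space (Pi\<^sub>M I (\<lambda>_. N))"
  then have "z \<in> H \<rightarrow> space N" using space_PiM_Pi assms by fastforce
  then have "(if risk A z d \<le> c then risk H z d else 0) \<le> max 0 (real (card H) * Max V)"
    if "d \<in> D" for d using risk_le_Max[of z H d] D_subset that by (auto simp: max_def)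
  then show "bdd_above ((\<lambda>d. if risk A z d \<le> c then risk H z d else 0) ` D)"
    by (rule bdd_aboveI2)
qed

text \<open>Turns a permutation of the data into one of the index sets, so that invariance of the
  law relates different left-out indices.\<close>

lemma opt_permute:
  assumes "\<pi> permutes I" "A \<subseteq> I" "H \<subseteq> I"
  shows "opt A H c (\<lambda>i\<in>I. z (\<pi> i)) = opt (\<pi> ` A) (\<pi> ` H) c (\<lambda>i\<in>I. z i)"
proof -
  have "risk B (\<lambda>i\<in>I. z (\<pi> i)) t = risk (\<pi> ` B) (\<lambda>i\<in>I. z i) t" if "B \<subseteq> I" for B t
  proof -
    have inj: "inj_on \<pi> B" using permutes_inj[OF assms(1)] by (rule inj_on_subset) auto
    show ?thesis
      unfolding risk_def sum.reindex[OF inj]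
      by (rule sum.cong) (use that permutes_in_image[OF assms(1)] in auto)
  qed
  with assms show ?thesis by (simp add: opt_def)
qed

section \<open>Expected leave-one-out losses under exchangeability\<close>

context
  fixes P :: "'w measure" and I :: "'i set" and Z :: "'i \<Rightarrow> 'w \<Rightarrow> 'z"
  assumes P: "prob_space P" and exch: "exchangeable P I N Z" and fin: "finite I"
begin

lemma vec_space: "\<omega> \<in> space P \<Longrightarrow> (\<lambda>i\<in>I. Z i \<omega>) \<in> I \<rightarrow> space N"
  by (rule space_PiM_Pi[OF measurable_space[OF exchangeable_vec_measurable_id[OF exch]]])

lemma opt_vec_measurable:
  assumes "A \<subseteq> I" "H \<subseteq> I"
  shows "(\<lambda>\<omega>. opt A H c (\<lambda>i\<in>I. Z i \<omega>)) \<in> borel_measurable P"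
  using exchangeable_vec_measurable_id[OF exch] opt_measurable[OF fin assms]
  by (rule measurable_compose)

lemma opt_vec_integrable:
  assumes "A \<subseteq> I" "H \<subseteq> I" "0 \<le> c"
  shows "integrable P (\<lambda>\<omega>. opt A H c (\<lambda>i\<in>I. Z i \<omega>))"
proof -
  interpret prob_space P by (rule P)
  show ?thesis
    using opt_vec_measurable[OF assms(1,2)] opt_nonneg[OF fin vec_space assms]
      opt_le_Max[OF fin vec_space assms]
    by (intro integrable_const_bound[of _ "real (card H) * Max V"]) auto
qed

lemma opt_vec_integral_permute:
  assumes "\<pi> permutes I" "A \<subseteq> I" "H \<subseteq> I"
  shows "(\<integral>\<omega>. opt (\<pi> ` A) (\<pi> ` H) c (\<lambda>i\<in>I. Z i \<omega>) \<partial>P) = (\<integral>\<omega>. opt A H c (\<lambda>i\<in>I. Z i \<omega>) \<partial>P)"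
  using exchangeable_integral[OF exch assms(1) opt_measurable[OF fin assms(2,3)], of c]
    opt_permute[OF assms, of c "\<lambda>i. Z i _"]
  by simp

lemma opt_vec_AE_permute:
  assumes "\<pi> permutes I" "A \<subseteq> I" "H \<subseteq> I" "AE \<omega> in P. q \<le> opt A H c (\<lambda>i\<in>I. Z i \<omega>)"
  shows "AE \<omega> in P. q \<le> opt (\<pi> ` A) (\<pi> ` H) c (\<lambda>i\<in>I. Z i \<omega>)"
proof -
  note [measurable] = opt_measurable[OF fin assms(2,3)]
  have "AE \<omega> in P. q \<le> opt A H c (\<lambda>i\<in>I. Z (\<pi> i) \<omega>)"
    by (rule exchangeable_AE[OF exch assms(1) _ assms(4)]) measurable
  then show ?thesis
    by (simp add: opt_permute[OF assms(1-3), of c "\<lambda>i. Z i _"])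
qed

lemma transpose_leave_out:
  assumes "j \<in> I" "k \<in> I"
  shows "Transposition.transpose j k permutes I" "Transposition.transpose j k ` {k} = {j}"
    "Transposition.transpose j k ` (I - {k}) = I - {j}" "Transposition.transpose j k ` I = I"
proof -
  show p: "Transposition.transpose j k permutes I" by (rule permutes_swap_id) fact+
  show s: "Transposition.transpose j k ` {k} = {j}" by simp
  show i: "Transposition.transpose j k ` I = I" by (rule permutes_image[OF p])
  show "Transposition.transpose j k ` (I - {k}) = I - {j}"
    by (simp only: image_set_diff[OF permutes_inj[OF p]] s i)
qed

lemma expectation_opt_leave_one_out_le:
  assumes k: "k \<in> I" and c: "0 \<le> c" "0 \<le> B"
    and bound: "AE \<omega> in P. \<forall>t\<in>\<Lambda>. ell t (Z k \<omega>) \<le> B"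
  shows "(\<integral>\<omega>. opt (I - {k}) {k} c (\<lambda>i\<in>I. Z i \<omega>) \<partial>P) \<le> (c + B) / real (card I)"
proof -
  interpret prob_space P by (rule P)
  \<comment> \<open>Calibration on all of \<open>I\<close> at the relaxed level
    \<open>c + B\<close>. Transpositions fix \<open>I\<close>, so the expectation of
    \<open>W j\<close> does not depend on \<open>j\<close>.\<close>
  define W where "W j \<omega> = opt I {j} (c + B) (\<lambda>i\<in>I. Z i \<omega>)" for j \<omega>
  have W_int: "integrable P (W j)" if "j \<in> I" for j
    unfolding W_def using that c by (intro opt_vec_integrable) auto
  have W_eq: "expectation (W j) = expectation (W k)" if "j \<in> I" for j
    using opt_vec_integral_permute[OF transpose_leave_out(1)[OF that k], of I "{k}" "c + B"]
      transpose_leave_out[OF that k] k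
    by (simp add: W_def[abs_def])
  have W_sum: "(\<Sum>j\<in>I. W j \<omega>) \<le> c + B" if \<omega>: "\<omega> \<in> space P" for \<omega>
  proof -
    obtain t where t: "risk I (\<lambda>i\<in>I. Z i \<omega>) t \<le> c + B"
      "\<And>H. H \<subseteq> I \<Longrightarrow> opt I H (c + B) (\<lambda>i\<in>I. Z i \<omega>) = risk H (\<lambda>i\<in>I. Z i \<omega>) t"
      using opt_attained[OF fin vec_space[OF \<omega>] order_refl, of "c + B"] c by (metis add_nonneg_nonneg)
    have "(\<Sum>j\<in>I. W j \<omega>) = (\<Sum>j\<in>I. risk {j} (\<lambda>i\<in>I. Z i \<omega>) t)"
      unfolding W_def by (rule sum.cong) (use t in auto)
    also have "\<dots> = risk I (\<lambda>i\<in>I. Z i \<omega>) t" by (simp add: risk_def)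
    finally show ?thesis using t by simp
  qed
  have "real (card I) * expectation (W k) = (\<Sum>j\<in>I. expectation (W j))"
    using W_eq by simp
  also have "\<dots> = expectation (\<lambda>\<omega>. \<Sum>j\<in>I. W j \<omega>)"
    using W_int by simp
  also have "\<dots> \<le> c + B"
    using W_int W_sum by (intro integral_le_const) auto
  finally have "expectation (W k) \<le> (c + B) / real (card I)"
    using k fin by (subst pos_le_divide_eq) (auto simp: card_gt_0_iff mult.commute)
  moreover have "expectation (\<lambda>\<omega>. opt (I - {k}) {k} c (\<lambda>i\<in>I. Z i \<omega>)) \<le> expectation (W k)"
  proof (rule integral_mono_AE)
    show "integrable P (\<lambda>\<omega>. opt (I - {k}) {k} c (\<lambda>i\<in>I. Z i \<omega>))"
      using k c by (intro opt_vec_integrable) auto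
    show "integrable P (W k)" by (rule W_int[OF k])
    show "AE \<omega> in P. opt (I - {k}) {k} c (\<lambda>i\<in>I. Z i \<omega>) \<le> W k \<omega>"
      using bound AE_space
    proof eventually_elim
      case (elim \<omega>)
      let ?z = "\<lambda>i\<in>I. Z i \<omega>"
      note z = vec_space[OF elim(2)]
      obtain t where t: "t \<in> \<Lambda>" "risk (I - {k}) ?z t \<le> c"
        "\<And>H. H \<subseteq> I \<Longrightarrow> opt (I - {k}) H c ?z = risk H ?z t"
        using opt_attained[OF fin z Diff_subset c(1)] by metis
      obtain s where s: "\<And>r i. r \<in> \<Lambda> \<Longrightarrow> risk I ?z r \<le> c + B \<Longrightarrow> i \<in> I \<Longrightarrow> ell r (?z i) \<le> ell s (?z i)"
        "\<And>H. H \<subseteq> I \<Longrightarrow> opt I H (c + B) ?z = risk H ?z s"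
        using opt_attained[OF fin z order_refl, of "c + B"] c by (metis add_nonneg_nonneg)
      \<comment> \<open>The loss of pair \<open>k\<close> is at most B, so a threshold feasible for
        \<open>I - {k}\<close> at level \<open>c\<close> is feasible for \<open>I\<close> at level
        \<open>c + B\<close>; there \<open>s\<close> dominates it.\<close>
      have "risk I ?z t = risk (I - {k}) ?z t + ell t (?z k)"
        unfolding risk_def by (subst sum.remove[OF fin k]) simp
      also have "\<dots> \<le> c + B" using t elim(1) k by (intro add_mono) auto
      finally show ?case
        using s(1)[OF t(1) _ k] s(2)[of "{k}"] t(3)[of "{k}"] k by (simp add: W_def risk_def)
    qed
  qed
  ultimately show ?thesis by linarith
qed

lemma expectation_opt_leave_one_out_ge:
  assumes k: "k \<in> I" and c: "0 \<le> c"
    and AE_q: "AE \<omega> in P. q \<le> opt (I - {k}) (I - {k}) c (\<lambda>i\<in>I. Z i \<omega>)"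
  shows "q / real (card I) \<le> (\<integral>\<omega>. opt (I - {k}) {k} c (\<lambda>i\<in>I. Z i \<omega>) \<partial>P)"
proof -
  interpret prob_space P by (rule P)
  define U where "U j \<omega> = opt (I - {j}) {j} c (\<lambda>i\<in>I. Z i \<omega>)" for j \<omega>
  have U_int: "integrable P (U j)" if "j \<in> I" for j
    unfolding U_def using that c by (intro opt_vec_integrable) auto
  have U_eq: "expectation (U j) = expectation (U k)" if "j \<in> I" for j
    using opt_vec_integral_permute[OF transpose_leave_out(1)[OF that k], of "I - {k}" "{k}" c]
      transpose_leave_out[OF that k] k
    by (simp add: U_def[abs_def])
  have "AE \<omega> in P. q \<le> opt (I - {j}) (I - {j}) c (\<lambda>i\<in>I. Z i \<omega>)" if "j \<in> I" for j
    using opt_vec_AE_permute[OF transpose_leave_out(1)[OF that k] _ _ AE_q]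
      transpose_leave_out[OF that k]
    by simp
  \<comment> \<open>All indices are needed outside a single null set, because the index
    \<open>m\<close> chosen below depends on \<omega>.\<close>
  then have all_q: "AE \<omega> in P. \<forall>j\<in>I. q \<le> opt (I - {j}) (I - {j}) c (\<lambda>i\<in>I. Z i \<omega>)"
    using fin by (intro AE_finite_allI) auto
  have U_sum: "AE \<omega> in P. q \<le> (\<Sum>j\<in>I. U j \<omega>)"
    using all_q AE_space
  proof eventually_elim
    case (elim \<omega>)
    let ?z = "\<lambda>i\<in>I. Z i \<omega>"
    note z = vec_space[OF elim(2)]
    have "\<forall>j\<in>I. \<exists>t. t \<in> \<Lambda> \<and> (\<forall>H\<subseteq>I. opt (I - {j}) H c ?z = risk H ?z t)"
      using opt_attained[OF fin z _ c] by (metis Diff_subset)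
    then obtain \<tau> where \<tau>: "\<And>j. j \<in> I \<Longrightarrow> \<tau> j \<in> \<Lambda>"
      "\<And>j H. j \<in> I \<Longrightarrow> H \<subseteq> I \<Longrightarrow> opt (I - {j}) H c ?z = risk H ?z (\<tau> j)"
      by metis
    obtain m where m: "m \<in> I" "\<And>j. j \<in> I \<Longrightarrow> \<tau> j \<le> \<tau> m"
    proof -
      have "Max (\<tau> ` I) \<in> \<tau> ` I" using fin k by (intro Max_in) auto
      then obtain m where "m \<in> I" "\<tau> m = Max (\<tau> ` I)" by auto
      then show thesis using fin by (intro that[of m]) auto
    qed
    \<comment> \<open>The loss of pair \<open>m\<close> is added back by nonnegativity; then
      lowering the common threshold \<open>\<tau> m\<close> to each \<open>\<tau> j\<close> can only
      increase the losses.\<close>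
    have "q \<le> risk (I - {m}) ?z (\<tau> m)" using elim(1) \<tau>(2)[OF m(1), of "I - {m}"] m by auto
    also have "\<dots> \<le> risk I ?z (\<tau> m)"
      unfolding risk_def
      by (rule sum_mono2[OF fin Diff_subset]) (use z \<tau>(1)[OF m(1)] ell_nonneg in \<open>auto simp: Pi_iff\<close>)
    also have "\<dots> = (\<Sum>j\<in>I. risk {j} ?z (\<tau> m))" by (simp add: risk_def)
    also have "\<dots> \<le> (\<Sum>j\<in>I. risk {j} ?z (\<tau> j))"
      by (rule sum_mono, rule risk_antimono) (use z \<tau>(1) m in \<open>auto simp: Pi_iff\<close>)
    also have "\<dots> = (\<Sum>j\<in>I. U j \<omega>)"
      unfolding U_def by (rule sum.cong) (use \<tau>(2) in auto)
    finally show ?case .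
  qed
  have "q \<le> expectation (\<lambda>\<omega>. \<Sum>j\<in>I. U j \<omega>)"
    using U_int U_sum by (intro integral_ge_const) auto
  also have "\<dots> = (\<Sum>j\<in>I. expectation (U j))"
    using U_int by simp
  also have "\<dots> = real (card I) * expectation (U k)"
    using U_eq by simp
  finally show ?thesis
    using k fin unfolding U_def[symmetric]
    by (subst pos_divide_le_eq) (auto simp: card_gt_0_iff mult.commute)
qed

end

text \<open>Right-continuity makes the infimum of the feasible thresholds feasible.\<close>

lemma opt_Inf:
  assumes I: "finite I" "z \<in> I \<rightarrow> space N" "A \<subseteq> I" "H \<subseteq> I"
    and S: "S = {t\<in>\<Lambda>. risk A z t \<le> c}" "S \<noteq> {}" "bdd_below S" "Inf S \<in> \<Lambda>"
  shows "opt A H c z = risk H z (Inf S)"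
proof (rule opt_eqI[OF I S(4)])
  obtain e where e: "e > 0" "\<forall>s\<in>\<Lambda>. Inf S \<le> s \<longrightarrow> s < Inf S + e \<longrightarrow> (\<forall>i\<in>I. ell s (z i) = ell (Inf S) (z i))"
    using risk_right_const[OF I(1,2) S(4)] by auto
  obtain s where s: "s \<in> S" "s < Inf S + e"
    using cInf_lessD[OF S(2), of "Inf S + e"] e by auto
  have "Inf S \<le> s" using cInf_lower[OF s(1) S(3)] .
  then have "risk A z s = risk A z (Inf S)"
    using e s S(1) by (intro risk_cong_ell[OF I(3)]) auto
  then show "risk A z (Inf S) \<le> c" using s S(1) by auto
next
  fix s i assume s: "s \<in> \<Lambda>" "risk A z s \<le> c" "i \<in> H"
  then have "Inf S \<le> s" using S by (intro cInf_lower) auto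
  then show "ell s (z i) \<le> ell (Inf S) (z i)"
    using ell_antimono s S I by (auto simp: Pi_iff subset_iff)
qed

text \<open>By \<open>lim\<close> there are thresholds of \<Lambda> just to the left of the infimum,
  all of them infeasible. Passing from them to the infimum costs only the jumps, at most M of which
  are positive.\<close>

lemma opt_Inf_ge:
  assumes I: "finite I" "z \<in> I \<rightarrow> space N" "A \<subseteq> I"
    and S: "S = {t\<in>\<Lambda>. risk A z t \<le> c}" "S \<noteq> {}" "bdd_below S" "Inf S \<in> \<Lambda>"
    and lim: "Inf S islimpt (\<Lambda> \<inter> {..<Inf S})"
    and bound: "\<And>i t. i \<in> A \<Longrightarrow> t \<in> \<Lambda> \<Longrightarrow> ell t (z i) \<le> B" and B: "0 \<le> B"
    and jumps: "card {i\<in>A. jump \<Lambda> (\<lambda>t. ell t (z i)) (Inf S) > 0} \<le> M"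
  shows "c - real M * B \<le> opt A A c z"
proof -
  let ?t = "Inf S" and ?J = "\<lambda>i. jump \<Lambda> (\<lambda>t. ell t (z i)) (Inf S)"
  have finA: "finite A" using I by (auto intro: finite_subset)
  have zA: "z i \<in> space N" if "i \<in> A" for i using I that by auto
  have "\<exists>s. s \<in> \<Lambda> \<and> s < ?t \<and> (\<forall>r\<in>\<Lambda>. s \<le> r \<longrightarrow> r < ?t \<longrightarrow> ?J i = ell r (z i) - ell ?t (z i))"
    if "i \<in> A" for i
  proof -
    have "antimono_on \<Lambda> (\<lambda>t. ell t (z i))"
      by (rule monotone_onI) (use ell_antimono zA that in auto)
    moreover have "finite ((\<lambda>t. ell t (z i)) ` \<Lambda>)"
      by (rule finite_subset[OF _ finite_values]) (use ell_values zA that in auto)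
    ultimately show ?thesis using jump_finite_range[OF _ _ lim] by metis
  qed
  then obtain \<sigma> where \<sigma>: "\<And>i. i \<in> A \<Longrightarrow> \<sigma> i \<in> \<Lambda>" "\<And>i. i \<in> A \<Longrightarrow> \<sigma> i < ?t"
    "\<And>i r. i \<in> A \<Longrightarrow> r \<in> \<Lambda> \<Longrightarrow> \<sigma> i \<le> r \<Longrightarrow> r < ?t \<Longrightarrow> ?J i = ell r (z i) - ell ?t (z i)"
    by metis
  obtain s\<^sub>0 where s\<^sub>0: "s\<^sub>0 \<in> \<Lambda>" "s\<^sub>0 < ?t" using lim by (auto simp: islimpt_def)
  \<comment> \<open>One point left of the infimum at which all losses already equal their left
    limits; \<open>s\<^sub>0\<close> covers the case of empty \<open>A\<close>.\<close>
  define s where "s = Max (insert s\<^sub>0 (\<sigma> ` A))"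
  have "s \<in> insert s\<^sub>0 (\<sigma> ` A)" unfolding s_def using finA by (intro Max_in) auto
  then have s: "s \<in> \<Lambda>" "s < ?t" using s\<^sub>0 \<sigma> by auto
  have J: "?J i = ell s (z i) - ell ?t (z i)" if "i \<in> A" for i
    using s that finA by (intro \<sigma>(3)) (auto simp: s_def)
  \<comment> \<open>A jump is a loss at \<open>s\<close>, at most B, minus a nonnegative loss at the
    infimum.\<close>
  have J_le: "?J i \<le> (if ?J i > 0 then B else 0)" if "i \<in> A" for i
    using J[OF that] bound[OF that s(1)] ell_nonneg[OF zA[OF that] S(4)] by auto
  have "s \<notin> S" using cInf_lower[OF _ S(3), of s] s by auto
  then have "c < risk A z s" using s S(1) by auto
  also have "risk A z s = risk A z ?t + (\<Sum>i\<in>A. ?J i)"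
    unfolding risk_def sum.distrib[symmetric] by (rule sum.cong) (use J in auto)
  also have "(\<Sum>i\<in>A. ?J i) \<le> (\<Sum>i\<in>A. if ?J i > 0 then B else 0)"
    by (rule sum_mono) (rule J_le)
  also have "\<dots> = real (card {i\<in>A. ?J i > 0}) * B"
    using finA by (simp add: sum.If_cases Int_def)
  also have "\<dots> \<le> real M * B" using jumps B by (intro mult_right_mono) auto
  finally show ?thesis using opt_Inf[OF I I(3) S] by simp
qed

end

section \<open>Risk bounds for ordinal prediction sets\<close>

theorem theorem1:
  fixes P :: "'w measure" and MX :: "'x measure"
    and X :: "nat \<Rightarrow> 'w \<Rightarrow> 'x" and Y :: "nat \<Rightarrow> 'w \<Rightarrow> int"
    and K n :: nat
    and \<Lambda> :: "real set" and t\<^sub>0 :: real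
    and l u :: "real \<Rightarrow> 'x \<Rightarrow> int"
    and g :: "int \<Rightarrow> int set \<Rightarrow> real"
    and \<alpha> B :: real
    and L :: "'w \<Rightarrow> nat \<Rightarrow> real \<Rightarrow> real"
    and lhat :: "'w \<Rightarrow> real"
  assumes P: "prob_space P"
    and exch: "exchangeable P {1..n+1} (MX \<Otimes>\<^sub>M count_space (labels K)) (\<lambda>i \<omega>. (X i \<omega>, Y i \<omega>))"
    and meas: "\<And>t. t \<in> \<Lambda> \<Longrightarrow> l t \<in> measurable MX (count_space UNIV)"
              "\<And>t. t \<in> \<Lambda> \<Longrightarrow> u t \<in> measurable MX (count_space UNIV)"
    and C_sub: "\<And>t x. t \<in> \<Lambda> \<Longrightarrow> x \<in> space MX \<Longrightarrow> pred_set l u t x \<subseteq> labels K"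
    and l_mono: "\<And>x. x \<in> space MX \<Longrightarrow> antimono_on \<Lambda> (\<lambda>t. l t x)"
    and u_mono: "\<And>x. x \<in> space MX \<Longrightarrow> mono_on \<Lambda> (\<lambda>t. u t x)"
    and l_rcont: "\<And>x. x \<in> space MX \<Longrightarrow> right_cont_on \<Lambda> (\<lambda>t. l t x)"
    and u_rcont: "\<And>x. x \<in> space MX \<Longrightarrow> right_cont_on \<Lambda> (\<lambda>t. u t x)"
    and top: "t\<^sub>0 \<in> \<Lambda>" "\<And>x. x \<in> space MX \<Longrightarrow> pred_set l u t\<^sub>0 x = labels K"
    and g_nonneg: "\<And>y C. y \<in> labels K \<Longrightarrow> C \<subseteq> labels K \<Longrightarrow> 0 \<le> g y C"
    and g_mono: "\<And>y C\<^sub>1 C\<^sub>2. y \<in> labels K \<Longrightarrow> C\<^sub>1 \<subseteq> C\<^sub>2 \<Longrightarrow> C\<^sub>2 \<subseteq> labels K \<Longrightarrow> g y C\<^sub>2 \<le> g y C\<^sub>1"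
    and L_def: "\<And>\<omega> i t. L \<omega> i t = ord_loss g (Y i \<omega>) (pred_set l u t (X i \<omega>))"
    and bound: "\<And>i. i \<in> {1..n+1} \<Longrightarrow> AE \<omega> in P. \<forall>t\<in>\<Lambda>. L \<omega> i t \<le> B"
    and alpha: "0 < \<alpha>" "\<alpha> < B"
    and lhat_def: "\<And>\<omega>. lhat \<omega> = threshold \<Lambda> t\<^sub>0 n \<alpha> B (L \<omega>)"
    \<comment> \<open>the infimum defining the threshold exists and indexes a prediction set\<close>
    and lhat_wd: "\<And>\<omega>. \<omega> \<in> space P \<Longrightarrow> calib_set \<Lambda> n \<alpha> B (L \<omega>) \<noteq> {} \<Longrightarrow>
                    bdd_below (calib_set \<Lambda> n \<alpha> B (L \<omega>)) \<and> lhat \<omega> \<in> \<Lambda>"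
  shows "prob_space.expectation P
           (\<lambda>\<omega>. ord_loss g (Y (n+1) \<omega>) (pred_set l u (lhat \<omega>) (X (n+1) \<omega>))) \<le> \<alpha> \<and>
         (\<forall>M::nat.
            iid_functions P {1..n+1} \<Lambda> L \<longrightarrow>
            (\<forall>i\<in>{1..n+1}. AE \<omega> in P. \<forall>t\<in>\<Lambda>. 0 \<le> L \<omega> i t) \<longrightarrow>
            (AE \<omega> in P. \<forall>t\<in>\<Lambda>. jump_count \<Lambda> n (L \<omega>) t \<le> M) \<longrightarrow>
            \<comment> \<open>the left limits at the threshold are defined\<close>
            (AE \<omega> in P. calib_set \<Lambda> n \<alpha> B (L \<omega>) \<noteq> {} \<longrightarrow> lhat \<omega> islimpt (\<Lambda> \<inter> {..<lhat \<omega>})) \<longrightarrow>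
            \<alpha> - (real M + 2) * B / (real n + 1) \<le>
              prob_space.expectation P
                (\<lambda>\<omega>. ord_loss g (Y (n+1) \<omega>) (pred_set l u (lhat \<omega>) (X (n+1) \<omega>))))"
proof -
  interpret prob_space P by (rule P)
  define N where "N = MX \<Otimes>\<^sub>M count_space (labels K)"
  define Z where "Z i \<omega> = (X i \<omega>, Y i \<omega>)" for i \<omega>
  define ell where "ell t z = ord_loss g (snd z) (pred_set l u t (fst z))" for t z
  \<comment> \<open>The loss is 0 or a weight at one of the finitely many pairs of a label and a set
    of labels.\<close>
  define V where "V = insert 0 ((\<lambda>(y, C). g y C) ` (labels K \<times> Pow (labels K)))"
  obtain D where D: "countable D" "D \<subseteq> \<Lambda>"
    "\<And>t e. t \<in> \<Lambda> \<Longrightarrow> e > 0 \<Longrightarrow> \<exists>d\<in>D. t \<le> d \<and> d < t + e"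
    using right_dense_countable by blast
  have N: "fst z \<in> space MX" "snd z \<in> labels K" if "z \<in> space N" for z
    using that by (auto simp: N_def space_pair_measure)
  have C_mono: "pred_set l u s x \<subseteq> pred_set l u t x"
    if "x \<in> space MX" "s \<in> \<Lambda>" "t \<in> \<Lambda>" "s \<le> t" for x s t
    using monotone_onD[OF l_mono[OF that(1)] that(2-4)] monotone_onD[OF u_mono[OF that(1)] that(2-4)]
    by (auto simp: pred_set_def)
  \<comment> \<open>The integers are discrete, so a right limit means equality near the
    point.\<close>
  have int_right_const: "\<exists>e>0. \<forall>s\<in>\<Lambda>. t \<le> s \<longrightarrow> s < t + e \<longrightarrow> f s = f t"
    if "right_cont_on \<Lambda> f" "t \<in> \<Lambda>" for t and f :: "real \<Rightarrow> int"
  proof -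
    have "eventually (\<lambda>s. f s = f t) (at t within (\<Lambda> \<inter> {t<..}))"
      using that by (auto simp: right_cont_on_def tendsto_discrete)
    then obtain e where "e > 0" "\<And>s. s \<in> \<Lambda> \<inter> {t<..} \<Longrightarrow> s \<noteq> t \<Longrightarrow> dist s t < e \<Longrightarrow> f s = f t"
      by (auto simp: eventually_at)
    then show ?thesis
      by (intro exI[of _ e]) (force simp: dist_real_def order_le_less)
  qed
  interpret step_loss N \<Lambda> D t\<^sub>0 V ell
  proof
    fix t assume t: "t \<in> \<Lambda>"
    have *: "(\<lambda>z. (snd z, l t (fst z), u t (fst z))) \<in>
        measurable N (count_space (labels K) \<Otimes>\<^sub>M (count_space UNIV \<Otimes>\<^sub>M count_space UNIV))"
      using meas[OF t] unfolding N_def by measurable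
    \<comment> \<open>The domain is countable and discrete, which makes any weight \<open>g\<close>
      measurable.\<close>
    have "(\<lambda>(y, a, b). ord_loss g y {a..b}) \<in> borel_measurable
        (count_space (labels K) \<Otimes>\<^sub>M (count_space (UNIV :: int set) \<Otimes>\<^sub>M count_space (UNIV :: int set)))"
      by (simp add: pair_measure_countable)
    from measurable_compose[OF * this] show "ell t \<in> borel_measurable N"
      by (simp add: ell_def[abs_def] pred_set_def)
  next
    fix s t z assume z: "z \<in> space N" and st: "s \<in> \<Lambda>" "t \<in> \<Lambda>" "s \<le> t"
    note C = C_mono[OF N(1)[OF z] st] C_sub[OF st(1) N(1)[OF z]] C_sub[OF st(2) N(1)[OF z]]
    \<comment> \<open>If the label enters the set between \<open>s\<close> and \<open>t\<close>, the
      loss drops to 0 and nonnegativity of \<open>g\<close> suffices; if it stays outside,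
      \<open>g_mono\<close> applies.\<close>
    show "ell t z \<le> ell s z"
      using g_mono[OF N(2)[OF z] C(1,3)] g_nonneg[OF N(2)[OF z] C(2)] C(1)
      by (auto simp: ell_def ord_loss_def of_bool_def)
  next
    fix t z assume z: "z \<in> space N" and t: "t \<in> \<Lambda>"
    note C = N(2)[OF z] C_sub[OF t N(1)[OF z]]
    show "0 \<le> ell t z" using g_nonneg[OF C] by (simp add: ell_def ord_loss_def)
    have "g (snd z) (pred_set l u t (fst z)) \<in> (\<lambda>(y, C). g y C) ` (labels K \<times> Pow (labels K))"
      by (rule image_eqI[of _ _ "(snd z, pred_set l u t (fst z))"]) (use C in auto)
    then show "ell t z \<in> V" by (auto simp: ell_def ord_loss_def V_def of_bool_def)
  next
    show "finite V" by (auto simp: V_def labels_def)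
  next
    fix t z assume z: "z \<in> space N" and t: "t \<in> \<Lambda>"
    obtain e e' where e: "e > 0" "\<forall>s\<in>\<Lambda>. t \<le> s \<longrightarrow> s < t + e \<longrightarrow> l s (fst z) = l t (fst z)"
      "e' > 0" "\<forall>s\<in>\<Lambda>. t \<le> s \<longrightarrow> s < t + e' \<longrightarrow> u s (fst z) = u t (fst z)"
      using int_right_const[OF l_rcont[OF N(1)[OF z]] t] int_right_const[OF u_rcont[OF N(1)[OF z]] t]
      by blast
    then show "\<exists>e>0. \<forall>s\<in>\<Lambda>. t \<le> s \<longrightarrow> s < t + e \<longrightarrow> ell s z = ell t z"
      by (intro exI[of _ "min e e'"]) (auto simp: ell_def pred_set_def)
  next
    fix z assume "z \<in> space N"
    then show "ell t\<^sub>0 z = 0" using top N by (simp add: ell_def ord_loss_def)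
  qed (use top D in auto)

  let ?I = "{1..n+1}" and ?k = "n+1" and ?c = "(real n + 1) * \<alpha> - B"
  let ?z = "\<lambda>\<omega>. \<lambda>i\<in>?I. Z i \<omega>" and ?T = "\<lambda>\<omega>. ell (lhat \<omega>) (Z ?k \<omega>)"
  have exZ: "exchangeable P ?I N Z" using exch by (simp add: N_def Z_def[abs_def])
  have fin: "finite ?I" and k: "?k \<in> ?I" by auto
  have I_minus: "?I - {?k} = {1..n}" by auto
  have card_I: "real (card ?I) = real n + 1" by simp
  have B: "0 \<le> B" using alpha by simp
  have L: "L \<omega> i = (\<lambda>t. ell t (Z i \<omega>))" for \<omega> i by (rule ext) (simp add: L_def ell_def Z_def)
  have Zspace: "?z \<omega> \<in> ?I \<rightarrow> space N" if "\<omega> \<in> space P" for \<omega>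
    by (rule vec_space[OF P exZ fin that])
  have calib: "calib_set \<Lambda> n \<alpha> B (L \<omega>) = {t\<in>\<Lambda>. risk (?I - {?k}) (?z \<omega>) t \<le> ?c}" for \<omega>
    unfolding I_minus calib_set_def L risk_def by (auto intro!: sum.cong arg_cong2[of _ _ _ _ "(\<le>)"])
  have T: "ord_loss g (Y ?k \<omega>) (pred_set l u (lhat \<omega>) (X ?k \<omega>)) = ?T \<omega>" for \<omega>
    by (simp add: ell_def Z_def)
  show ?thesis
  proof (cases "0 \<le> ?c")
    \<comment> \<open>Losses are nonnegative, so no threshold is feasible; the default
      \<open>t\<^sub>0\<close> is used and the test loss is 0.\<close>
    case False
    have "?T \<omega> = 0" if \<omega>: "\<omega> \<in> space P" for \<omega>
    proof -
      have "calib_set \<Lambda> n \<alpha> B (L \<omega>) = {}"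
        unfolding calib using False risk_nonneg[of "?z \<omega>" "?I - {?k}"] Zspace[OF \<omega>] by force
      then have "lhat \<omega> = t\<^sub>0" by (simp add: lhat_def threshold_def)
      then show ?thesis using ell_top[of "Z ?k \<omega>"] Zspace[OF \<omega>] k by (auto simp: Pi_iff)
    qed
    then have E: "expectation ?T = 0" by (simp cong: Bochner_Integration.integral_cong)
    \<comment> \<open>A negative \<open>?c\<close> means (n + 1) \<alpha> < B, and B is at most (M +
      2) B.\<close>
    have "\<alpha> - (real M + 2) * B / (real n + 1) \<le> 0" for M :: nat
    proof -
      have "(real n + 1) * \<alpha> \<le> 1 * B" using False by simp
      also have "\<dots> \<le> (real M + 2) * B" using B by (intro mult_right_mono) auto
      finally show ?thesis by (simp add: field_simps)
    qed
    then show ?thesis unfolding T E using alpha by auto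
  next
    case c: True
    have ne: "calib_set \<Lambda> n \<alpha> B (L \<omega>) \<noteq> {}" if \<omega>: "\<omega> \<in> space P" for \<omega>
    proof -
      obtain t where "t \<in> \<Lambda>" "risk (?I - {?k}) (?z \<omega>) t \<le> ?c"
        using opt_attained[OF fin Zspace[OF \<omega>] Diff_subset c] by metis
      then show ?thesis unfolding calib by blast
    qed
    have lhat: "lhat \<omega> = Inf (calib_set \<Lambda> n \<alpha> B (L \<omega>))" if "\<omega> \<in> space P" for \<omega>
      using ne[OF that] by (simp add: lhat_def threshold_def)
    have wd: "bdd_below (calib_set \<Lambda> n \<alpha> B (L \<omega>))" "Inf (calib_set \<Lambda> n \<alpha> B (L \<omega>)) \<in> \<Lambda>"
      if "\<omega> \<in> space P" for \<omega>
      using lhat_wd[OF that ne[OF that]] lhat[OF that] by auto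
    \<comment> \<open>Identifies the test loss at the random threshold with a function already known
      to be measurable and integrable.\<close>
    have T_opt: "?T \<omega> = opt (?I - {?k}) {?k} ?c (?z \<omega>)" if \<omega>: "\<omega> \<in> space P" for \<omega>
      using opt_Inf[OF fin Zspace[OF \<omega>] Diff_subset _ calib ne[OF \<omega>] wd[OF \<omega>], of "{?k}"] k lhat[OF \<omega>]
      by (simp add: risk_def)
    have E: "expectation ?T = expectation (\<lambda>\<omega>. opt (?I - {?k}) {?k} ?c (?z \<omega>))"
      by (rule Bochner_Integration.integral_cong) (use T_opt in auto)
    have "expectation ?T \<le> (?c + B) / real (card ?I)"
      unfolding E
      by (rule expectation_opt_leave_one_out_le[OF P exZ fin k c B]) (use bound[OF k] in \<open>simp add: L\<close>)
    then have upper: "expectation ?T \<le> \<alpha>" unfolding card_I by simp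
    have lower: "\<alpha> - (real M + 2) * B / (real n + 1) \<le> expectation ?T"
      if jumps: "AE \<omega> in P. \<forall>t\<in>\<Lambda>. jump_count \<Lambda> n (L \<omega>) t \<le> M"
        and lim: "AE \<omega> in P. calib_set \<Lambda> n \<alpha> B (L \<omega>) \<noteq> {} \<longrightarrow> lhat \<omega> islimpt (\<Lambda> \<inter> {..<lhat \<omega>})"
      for M :: nat
    proof -
      have bounds: "AE \<omega> in P. \<forall>i\<in>?I. \<forall>t\<in>\<Lambda>. L \<omega> i t \<le> B"
        by (rule AE_finite_allI[OF fin bound])
      have "AE \<omega> in P. ?c - real M * B \<le> opt (?I - {?k}) (?I - {?k}) ?c (?z \<omega>)"
        using jumps lim bounds AE_space
      proof eventually_elim
        case (elim \<omega>)
        note S = calib[of \<omega>] ne[OF elim(4)] wd[OF elim(4)]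
        let ?t = "Inf (calib_set \<Lambda> n \<alpha> B (L \<omega>))"
        \<comment> \<open>The jump count is bounded for all thresholds outside one null set, so the
          bound applies at the random threshold; leaving out the test index only shrinks the
          count.\<close>
        have "card {i\<in>?I - {?k}. jump \<Lambda> (\<lambda>t. ell t (?z \<omega> i)) ?t > 0} \<le> jump_count \<Lambda> n (L \<omega>) ?t"
          unfolding jump_count_def L by (rule card_mono) auto
        also have "\<dots> \<le> M" using elim(1) S(4) by blast
        finally show ?case
          using elim(2,3) S(2) B lhat[OF elim(4)]
          by (intro opt_Inf_ge[OF fin Zspace[OF elim(4)] Diff_subset S]) (auto simp: L)
      qed
      from expectation_opt_leave_one_out_ge[OF P exZ fin k c this]
      have "(?c - real M * B) / (real n + 1) \<le> expectation ?T" unfolding E card_I .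
      \<comment> \<open>The right-hand side equals \<alpha> - (M + 1) B / (n + 1), which exceeds the
        left-hand side by B / (n + 1).\<close>
      moreover have "\<alpha> - (real M + 2) * B / (real n + 1) \<le> (?c - real M * B) / (real n + 1)"
        using B by (simp add: field_simps)
      ultimately show ?thesis by linarith
    qed
    show ?thesis unfolding T using upper lower by blast
  qed
qed

end
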